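(* Let $\beta,\beta'$ be two observers in Minkowski spacetime with 4-velocities $U,U'$ respectively. Let $S$ be the relative position of $\beta'$ with respect to $\beta$, and let $V_{\mathrm{Fermi}}$ be the Fermi relative velocity of $\beta'$ with respect to $\beta$. Then, at every event $p$ of $\beta$, $$V_{\mathrm{Fermi}}=\bigl(1+g(S,\nabla_U U)\bigr)\left(\frac{1}{-g(U',U)}\,U'-U\right),$$ where $V_{\mathrm{Fermi}}$, $U$, $S$, $\nabla_U U$ are evaluated at $p$, and $U'$ is evaluated at $q$, the unique event of $\beta'\cap L_{p,U_p}$ (vectors at $q$ and at $p$ being identified by the affine structure of Minkowski spacetime).
   Context: Minkowski spacetime is the 4-dimensional affine space with flat metric $g$ of signature $(-,+,+,+)$, $c=1$, with a fixed time orientation; $\nabla$ is the Levi-Civita connection (so, for a vector field $X$ along $\beta$ with $\beta$ parameterized by proper time $\tau$, $\nabla_U X=\frac{dX}{d\tau}$). For events $p,q$, $q-p$ denotes the vector joining $p$ to $q$. An observer is a (smooth) future-directed timelike curve $\beta:I\to\mathcal M$, with $I\subset\mathbb R$ an interval, parameterized by proper time and identified with its image; its 4-velocity $U$ is its tangent field, which satisfies $g(U,U)=-1$. For an event $p$ and a future-pointing timelike unit vector $u$ at $p$, $L_{p,u}=\{q : g(q-p,u)=0\}$. Relative position: it is assumed that for every $p\in\beta$ there is a unique event $q$ of $\beta'\cap L_{p,U_p}$. The relative position of $\beta'$ with respect to $\beta$ is the vector field $S$ along $\beta$ given by $S_p=q-p$. Fermi relative velocity of $\beta'$ with respect to $\beta$: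 the vector field along $\beta$ $V_{\mathrm{Fermi}}:=\nabla_U S+g(\nabla_U S,U)\,U$, i.e. the projection of $\nabla_U S$ onto $U^{\perp}$. *)

theory Defs
  imports "HOL-Analysis.Analysis"
begin

text \<open>
  Minkowski spacetime in inertial coordinates (t, x): the first component is time and c = 1. Events
  and vectors share one type, so the vector from p to q is q - p, vectors at different events are
  identified, and the Levi-Civita connection is componentwise differentiation. The time orientation
  is the one for which (1, 0) points to the future.
\<close>

type_synonym minkowski = "real \<times> (real ^ 3)"

definition mink :: "minkowski \<Rightarrow> minkowski \<Rightarrow> real"
  where "mink v w = - (fst v * fst w) + snd v \<bullet> snd w"

definition timelike :: "minkowski \<Rightarrow> bool"
  where "timelike v \<longleftrightarrow> mink v v < 0"

definition future_timelike :: "minkowski \<Rightarrow> bool"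
  where "future_timelike v \<longleftrightarrow> timelike v \<and> fst v > 0"

text \<open>
  For a curve or a vector field X along a curve, as a function of the parameter in the interval I,
  this is dX/d\<tau>; it is one-sided at an end point belonging to I. If I is the domain of a curve
  parameterized by proper time with 4-velocity U, it is the covariant derivative of X along U.
\<close>

definition ddtau :: "real set \<Rightarrow> (real \<Rightarrow> minkowski) \<Rightarrow> real \<Rightarrow> minkowski"
  where "ddtau I X \<tau> = vector_derivative X (at \<tau> within I)"

definition smooth_curve_on :: "real set \<Rightarrow> (real \<Rightarrow> minkowski) \<Rightarrow> bool"
  where "smooth_curve_on I X \<longleftrightarrow> (\<forall>n. (ddtau I ^^ n) X differentiable_on I)"

definition four_velocity :: "real set \<Rightarrow> (real \<Rightarrow> minkowski) \<Rightarrow> real \<Rightarrow> minkowski"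
  where "four_velocity I \<beta> = ddtau I \<beta>"

text \<open>The domain is any interval with more than one point, with or without its end points.\<close>

definition observer :: "real set \<Rightarrow> (real \<Rightarrow> minkowski) \<Rightarrow> bool"
  where "observer I \<beta> \<longleftrightarrow>
    is_interval I \<and> interior I \<noteq> {} \<and> smooth_curve_on I \<beta> \<and>
    (\<forall>\<tau>\<in>I. future_timelike (four_velocity I \<beta> \<tau>) \<and>
           mink (four_velocity I \<beta> \<tau>) (four_velocity I \<beta> \<tau>) = -1)"

definition simultaneity_space :: "minkowski \<Rightarrow> minkowski \<Rightarrow> minkowski set"
  where "simultaneity_space p u = {q. mink (q - p) u = 0}"

text \<open>
  Fields along \<beta> are functions of its proper time \<tau> (\<beta> is injective, as its time coordinate is
  strictly increasing). The definite description below is only meaningful under the existence and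
  uniqueness condition stated first.
\<close>

definition relative_position_exists ::
    "real set \<Rightarrow> (real \<Rightarrow> minkowski) \<Rightarrow> real set \<Rightarrow> (real \<Rightarrow> minkowski) \<Rightarrow> bool"
  where "relative_position_exists I \<beta> I' \<beta>' \<longleftrightarrow>
    (\<forall>\<tau>\<in>I. \<exists>!q. q \<in> \<beta>' ` I' \<inter> simultaneity_space (\<beta> \<tau>) (four_velocity I \<beta> \<tau>))"

definition relative_position ::
    "real set \<Rightarrow> (real \<Rightarrow> minkowski) \<Rightarrow> real set \<Rightarrow> (real \<Rightarrow> minkowski) \<Rightarrow> real \<Rightarrow> minkowski"
  where "relative_position I \<beta> I' \<beta>' \<tau> =
    (THE q. q \<in> \<beta>' ` I' \<inter> simultaneity_space (\<beta> \<tau>) (four_velocity I \<beta> \<tau>)) - \<beta> \<tau>"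

definition fermi_velocity ::
    "real set \<Rightarrow> (real \<Rightarrow> minkowski) \<Rightarrow> real set \<Rightarrow> (real \<Rightarrow> minkowski) \<Rightarrow> real \<Rightarrow> minkowski"
  where "fermi_velocity I \<beta> I' \<beta>' \<tau> =
    (let U = four_velocity I \<beta> \<tau>; DS = ddtau I (relative_position I \<beta> I' \<beta>') \<tau>
     in DS + mink DS U *\<^sub>R U)"

end

theory Submission
  imports Defs
begin

text \<open>
  Let s(\<tau>) be the proper time at which \<beta>' meets the simultaneity space of \<beta> at \<tau>, so that
  g(\<beta>'(s(\<tau>)) - \<beta>(\<tau>), U(\<tau>)) = 0. The reversed Cauchy-Schwarz inequality g(U', U) \<le> -1 shows
  that \<sigma> \<mapsto> g(\<beta>'(\<sigma>) - \<beta>(\<tau>), U(\<tau>)) decreases at rate at least 1. This makes s well defined and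
  continuous, and replaces the implicit function theorem, also at end points of the two domains.
  Differentiating the defining equation gives s' = (1 + g(S, \<nabla>U)) / (- g(U', U)), where \<nabla> is differentiation along U. Then
  \<nabla>S = s' U' - U, and the formula is its projection onto the orthogonal complement of U.
\<close>

text \<open>Reflecting the time component of one argument turns \<open>mink\<close> into the
  Euclidean inner product. The interpretation below then supplies the product rule and limits for
  \<open>mink\<close>.\<close>

lemma bounded_bilinear_mink: "bounded_bilinear mink"
proof -
  have "bounded_linear (\<lambda>w :: minkowski. (- fst w, snd w))"
    by (intro bounded_linear_Pair bounded_linear_minus bounded_linear_fst bounded_linear_snd)
  then have "bounded_bilinear (\<lambda>v w :: minkowski. v \<bullet> (- fst w, snd w))"
    using bounded_bilinear.comp[OF bounded_bilinear_inner bounded_linear_ident] by blast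
  moreover have "mink = (\<lambda>v w. v \<bullet> (- fst w, snd w))"
    by (simp add: mink_def inner_prod_def fun_eq_iff)
  ultimately show ?thesis
    by simp
qed

interpretation mink: bounded_bilinear mink
  by (rule bounded_bilinear_mink)

text \<open>The unit condition fixes each time component through the norm of the spatial part, a or
  b. The gap between (1 + a^2)(1 + b^2) and (1 + a b)^2 is (a - b)^2, and ordinary Cauchy-Schwarz
  handles the spatial product.\<close>

lemma mink_future_unit_le:
  assumes "future_timelike u" "mink u u = -1" "future_timelike v" "mink v v = -1"
  shows "mink u v \<le> -1"
proof -
  define a b where "a = norm (snd u)" and "b = norm (snd v)"
  have u: "(fst u)\<^sup>2 = 1 + a\<^sup>2" and v: "(fst v)\<^sup>2 = 1 + b\<^sup>2"
    using assms by (simp_all add: mink_def a_def b_def dot_square_norm flip: power2_eq_square)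
  have pos: "fst u > 0" "fst v > 0"
    using assms by (simp_all add: future_timelike_def)
  have "(1 + a * b)\<^sup>2 \<le> (1 + a\<^sup>2) * (1 + b\<^sup>2)"
    using zero_le_power2[of "a - b"] by (simp add: power2_eq_square algebra_simps)
  then have "(1 + a * b)\<^sup>2 \<le> (fst u * fst v)\<^sup>2"
    by (simp add: power_mult_distrib u v)
  then have "1 + a * b \<le> fst u * fst v"
    using pos by (intro power2_le_imp_le[of "1 + a * b"]) auto
  moreover have "snd u \<bullet> snd v \<le> a * b"
    unfolding a_def b_def by (rule norm_cauchy_schwarz)
  ultimately show ?thesis
    by (simp add: mink_def)
qed

text \<open>The slope function \<open>Q\<close> is total, with the derivative filled in at
  \<open>x\<close>. It allows composition with s without dividing by an increment of s, which may
  vanish.\<close>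

lemma has_vector_derivative_caratheodory:
  fixes f :: "real \<Rightarrow> 'a::real_normed_vector"
  assumes "(f has_vector_derivative D) (at x within S)"
  obtains Q where "\<And>y. f y - f x = (y - x) *\<^sub>R Q y" "continuous (at x within S) Q" "Q x = D"
proof
  define Q where "Q y = (if y = x then D else (f y - f x) /\<^sub>R (y - x))" for y
  show "f y - f x = (y - x) *\<^sub>R Q y" for y
    by (simp add: Q_def)
  show "Q x = D"
    by (simp add: Q_def)
  have "((\<lambda>y. norm (f y - f x - (y - x) *\<^sub>R D) / norm (y - x)) \<longlongrightarrow> 0) (at x within S)"
    using assms by (simp add: has_vector_derivative_def has_derivative_iff_norm)
  moreover have "norm (f y - f x - (y - x) *\<^sub>R D) / norm (y - x) = norm (Q y - D)" if "y \<noteq> x" for y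
  proof -
    have "f y - f x - (y - x) *\<^sub>R D = (y - x) *\<^sub>R (Q y - D)"
      using that by (simp add: Q_def scaleR_diff_right)
    then show ?thesis
      using that by simp
  qed
  ultimately have "((\<lambda>y. norm (Q y - D)) \<longlongrightarrow> 0) (at x within S)"
    by (subst (asm) Lim_cong_within[OF refl refl refl]) auto
  then show "continuous (at x within S) Q"
    unfolding continuous_within \<open>Q x = D\<close> by (rule LIM_zero_cancel[OF tendsto_norm_zero_cancel])
qed

lemma observer_has_derivative:
  assumes "observer I \<beta>" "t \<in> I"
  shows "(\<beta> has_vector_derivative four_velocity I \<beta> t) (at t within I)"
    and "(four_velocity I \<beta> has_vector_derivative ddtau I (four_velocity I \<beta>) t) (at t within I)"
proof -
  have diff: "(ddtau I ^^ n) \<beta> differentiable_on I" for n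
    using assms(1) by (simp add: observer_def smooth_curve_on_def)
  have *: "(X has_vector_derivative ddtau I X t) (at t within I)" if "X differentiable_on I" for X
    using that assms(2)
    by (simp add: ddtau_def differentiable_on_def flip: vector_derivative_works)
  show "(\<beta> has_vector_derivative four_velocity I \<beta> t) (at t within I)"
    using *[of \<beta>] diff[of 0] by (simp add: four_velocity_def)
  show "(four_velocity I \<beta> has_vector_derivative ddtau I (four_velocity I \<beta>) t) (at t within I)"
    using *[of "four_velocity I \<beta>"] diff[of 1] by (simp add: four_velocity_def[abs_def])
qed

text \<open>Derivatives within \<open>I\<close> are unique only at limit points of \<open>I\<close>;
  a connected set with more than one point has no isolated points.\<close>

lemma observer_within_nontrivial:
  assumes "observer I \<beta>" "t \<in> I"
  shows "at t within I \<noteq> bot"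
proof -
  have "I \<noteq> {x}" for x
    using assms(1) by (auto simp: observer_def)
  then have "t islimpt I"
    using assms by (intro connected_imp_perfect) (auto simp: observer_def is_interval_connected)
  then show ?thesis
    by (simp add: trivial_limit_within)
qed

text \<open>Mean value theorem: the derivative of \<open>mink (\<beta> t) u\<close> in t is the
  product of two future unit vectors, hence at most -1.\<close>

lemma observer_mink_mono:
  assumes "observer I \<beta>" "future_timelike u" "mink u u = -1" "a \<in> I" "b \<in> I" "a < b"
  shows "b - a \<le> mink (\<beta> a - \<beta> b) u"
proof -
  have "is_interval I"
    using assms(1) by (simp add: observer_def)
  then have sub: "{a..b} \<subseteq> I"
    using assms(4,5) unfolding is_interval_1 by (meson atLeastAtMost_iff subsetI)
  have "((\<lambda>t. mink (\<beta> t) u) has_derivative (\<lambda>h. h * mink (four_velocity I \<beta> t) u)) (at t within {a..b})"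
    if "a \<le> t" "t \<le> b" for t
  proof -
    have "t \<in> I"
      using that sub by auto
    then have "(\<beta> has_vector_derivative four_velocity I \<beta> t) (at t within {a..b})"
      using observer_has_derivative(1)[OF assms(1)] sub has_vector_derivative_within_subset by blast
    from mink.has_vector_derivative[OF this has_vector_derivative_const]
    show ?thesis
      by (simp add: has_vector_derivative_def mink.zero_right)
  qed
  from mvt_simple[OF \<open>a < b\<close> this] obtain t where t: "t \<in> {a<..<b}"
    "mink (\<beta> b) u - mink (\<beta> a) u = (b - a) * mink (four_velocity I \<beta> t) u"
    by blast
  have "t \<in> I"
    using t(1) sub by auto
  then have "mink (four_velocity I \<beta> t) u \<le> -1"
    using assms by (intro mink_future_unit_le) (auto simp: observer_def)
  then have "(b - a) * mink (four_velocity I \<beta> t) u \<le> (b - a) * (-1)"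
    using assms by (intro mult_left_mono) auto
  then show ?thesis
    using t(2) by (simp add: mink.diff_left)
qed

text \<open>With right-hand side 0 this identifies two meeting times; with a right-hand side tending
  to 0 it gives continuity of s.\<close>

lemma observer_mink_expand:
  assumes "observer I \<beta>" "future_timelike u" "mink u u = -1" "a \<in> I" "b \<in> I"
  shows "\<bar>a - b\<bar> \<le> \<bar>mink (\<beta> a - \<beta> b) u\<bar>"
  using observer_mink_mono[OF assms(1-3), of a b] observer_mink_mono[OF assms(1-3), of b a] assms(4-5)
  by (cases a b rule: linorder_cases) (auto simp: mink.diff_left)

lemma simultaneity_parameter_has_derivative:
  assumes obs: "observer I \<beta>" "observer I' \<beta>'"
    and "U = four_velocity I \<beta>" "U' = four_velocity I' \<beta>'"
    and s: "\<And>t. t \<in> I \<Longrightarrow> s t \<in> I' \<and> \<beta>' (s t) \<in> simultaneity_space (\<beta> t) (U t)"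
    and t: "t \<in> I"
  shows "(s has_vector_derivative
      (1 + mink (\<beta>' (s t) - \<beta> t) (ddtau I U t)) / (- mink (U' (s t)) (U t))) (at t within I)"
proof -
  let ?F = "at t within I"
  have unit: "future_timelike (U r)" "mink (U r) (U r) = -1" if "r \<in> I" for r
    using obs(1) that assms(3) by (auto simp: observer_def)
  have unit': "future_timelike (U' r)" "mink (U' r) (U' r) = -1" if "r \<in> I'" for r
    using obs(2) that assms(4) by (auto simp: observer_def)
  have U: "(\<beta> has_vector_derivative U t) ?F" "(U has_vector_derivative ddtau I U t) ?F"
    using observer_has_derivative[OF obs(1) t] assms(3) by auto
  \<comment> \<open>Freezing the event on \<beta>' at \<open>s t\<close> leaves a function of r that
    is differentiable by the product rule. The 1 in \<open>f'\<close> is - g(U, U).\<close>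
  define f where "f r = mink (\<beta>' (s t) - \<beta> r) (U r)" for r
  define f' where "f' = 1 + mink (\<beta>' (s t) - \<beta> t) (ddtau I U t)"
  have "((\<lambda>r. \<beta>' (s t) - \<beta> r) has_vector_derivative - U t) ?F"
    using has_vector_derivative_diff[OF has_vector_derivative_const U(1)] by simp
  from mink.has_vector_derivative[OF this U(2)]
  have f_deriv: "(f has_vector_derivative f') ?F"
    using unit(2)[OF t] by (simp add: f_def[abs_def] f'_def mink.minus_left add.commute)
  have f_t: "f t = 0"
    using s[OF t] by (simp add: f_def simultaneity_space_def)
  have F: "mink (\<beta>' (s r) - \<beta>' (s t)) (U r) = - f r" if "r \<in> I" for r
    using s[OF that] by (simp add: f_def simultaneity_space_def mink.diff_left)

  have ev: "eventually (\<lambda>r. r \<in> I) ?F"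
    by (simp add: eventually_at_filter)
  have "continuous ?F f"
    using f_deriv has_vector_derivative_continuous by blast
  then have "(f \<longlongrightarrow> 0) ?F"
    by (simp add: continuous_within f_t)
  moreover have "norm (s r - s t) \<le> norm (f r)" if "r \<in> I" for r
    using observer_mink_expand[OF obs(2) unit[OF that], of "s r" "s t"] s[OF that] s[OF t] F[OF that]
    by simp
  then have "eventually (\<lambda>r. norm (s r - s t) \<le> norm (f r)) ?F"
    using ev by (rule eventually_mono[rotated])
  ultimately have "((\<lambda>r. s r - s t) \<longlongrightarrow> 0) ?F"
    by (rule Lim_null_comparison[rotated, OF tendsto_norm_zero])
  then have s_tendsto: "(s \<longlongrightarrow> s t) ?F"
    by (rule LIM_zero_cancel)

  have "(\<beta>' has_vector_derivative U' (s t)) (at (s t) within I')"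
    using observer_has_derivative(1)[OF obs(2)] s[OF t] assms(4) by simp
  then obtain Q where Q: "\<And>y. \<beta>' y - \<beta>' (s t) = (y - s t) *\<^sub>R Q y"
    "continuous (at (s t) within I') Q" "Q (s t) = U' (s t)"
    using has_vector_derivative_caratheodory by metis
  \<comment> \<open>The Caratheodory slope of \<beta>' turns \<open>F\<close> into the exact
    identity \<open>product\<close>, in which the increment of s is a factor. Dividing by r - t and
    by \<open>m r\<close> yields its difference quotient.\<close>
  define m where "m r = mink (Q (s r)) (U r)" for r
  have "eventually (\<lambda>r. s r \<in> I') ?F"
    using ev by eventually_elim (use s in auto)
  from continuous_within_tendsto_compose[OF Q(2) this s_tendsto]
  have "((\<lambda>r. Q (s r)) \<longlongrightarrow> U' (s t)) ?F"
    by (simp add: Q(3))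
  moreover have "(U \<longlongrightarrow> U t) ?F"
    using has_vector_derivative_continuous[OF U(2)] by (simp add: continuous_within)
  ultimately have m: "(m \<longlongrightarrow> mink (U' (s t)) (U t)) ?F"
    unfolding m_def by (rule mink.tendsto)
  have m_t: "mink (U' (s t)) (U t) \<le> -1"
    using unit unit' s t by (intro mink_future_unit_le) auto
  have product: "(s r - s t) * m r = - f r" if "r \<in> I" for r
    using F[OF that] by (simp add: Q(1) m_def mink.scaleR_left)

  have "((\<lambda>r. (f r - f t) / (r - t)) \<longlongrightarrow> f') ?F"
    using f_deriv by (simp add: has_field_derivative_iff flip: has_real_derivative_iff_has_vector_derivative)
  then have "((\<lambda>r. (f r - f t) / (r - t) / (- m r)) \<longlongrightarrow> f' / (- mink (U' (s t)) (U t))) ?F"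
    using m m_t by (intro tendsto_intros) auto
  moreover have "eventually (\<lambda>r. m r < 0) ?F"
    using order_tendstoD(2)[OF m, of 0] m_t by simp
  \<comment> \<open>The limit of \<open>m\<close> is at most -1, so division by \<open>m r\<close>
    is legitimate near t.\<close>
  then have "eventually (\<lambda>r. (f r - f t) / (r - t) / (- m r) = (s r - s t) / (r - t)) ?F"
    using ev
  proof eventually_elim
    case (elim r)
    then have "f r = (s r - s t) * (- m r)"
      using product[of r] by simp
    then show ?case
      using elim by (simp add: f_t)
  qed
  ultimately have "((\<lambda>r. (s r - s t) / (r - t)) \<longlongrightarrow> f' / (- mink (U' (s t)) (U t))) ?F"
    by (rule Lim_transform_eventually)
  then show ?thesis
    by (simp add: has_field_derivative_iff f'_def flip: has_real_derivative_iff_has_vector_derivative)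
qed

theorem proposition5p1:
  fixes I I' :: "real set" and \<beta> \<beta>' U U' S :: "real \<Rightarrow> minkowski"
  assumes "observer I \<beta>" and "observer I' \<beta>'"
    and "relative_position_exists I \<beta> I' \<beta>'"
    and "U = four_velocity I \<beta>" and "U' = four_velocity I' \<beta>'"
    and "S = relative_position I \<beta> I' \<beta>'"
  shows "\<forall>\<tau>\<in>I. \<forall>\<tau>'\<in>I'. \<beta>' \<tau>' \<in> simultaneity_space (\<beta> \<tau>) (U \<tau>) \<longrightarrow>
    fermi_velocity I \<beta> I' \<beta>' \<tau> =
      (1 + mink (S \<tau>) (ddtau I U \<tau>)) *\<^sub>R ((1 / (- mink (U' \<tau>') (U \<tau>))) *\<^sub>R U' \<tau>' - U \<tau>)"
proof (intro ballI impI)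
  fix \<tau> \<tau>'
  assume \<tau>: "\<tau> \<in> I" and \<tau>': "\<tau>' \<in> I'" "\<beta>' \<tau>' \<in> simultaneity_space (\<beta> \<tau>) (U \<tau>)"
  have unit: "future_timelike (U \<tau>)" "mink (U \<tau>) (U \<tau>) = -1"
    using assms(1,4) \<tau> by (auto simp: observer_def)
  have "future_timelike (U' \<tau>')" "mink (U' \<tau>') (U' \<tau>') = -1"
    using assms(2,5) \<tau>' by (auto simp: observer_def)
  then have neg: "mink (U' \<tau>') (U \<tau>) \<le> -1"
    using mink_future_unit_le unit by blast

  have unique: "\<exists>!q. q \<in> \<beta>' ` I' \<inter> simultaneity_space (\<beta> t) (U t)" if "t \<in> I" for t
    using assms(3,4) that by (simp add: relative_position_exists_def)
  then have "\<forall>t\<in>I. \<exists>r. r \<in> I' \<and> \<beta>' r \<in> simultaneity_space (\<beta> t) (U t)"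
    by blast
  then obtain s where s: "\<And>t. t \<in> I \<Longrightarrow> s t \<in> I' \<and> \<beta>' (s t) \<in> simultaneity_space (\<beta> t) (U t)"
    by metis
  have S: "S t = \<beta>' (s t) - \<beta> t" if "t \<in> I" for t
    using the1_equality[OF unique[OF that], of "\<beta>' (s t)"] s[OF that] assms(4,6)
    by (simp add: relative_position_def)
  \<comment> \<open>Both events lie in the same simultaneity space, so their difference is
    orthogonal to \<open>U \<tau>\<close>, and the expansion estimate forces equal proper
    times.\<close>
  have "mink (\<beta>' (s \<tau>) - \<beta>' \<tau>') (U \<tau>) = 0"
    using s[OF \<tau>] \<tau>'(2) by (simp add: simultaneity_space_def mink.diff_left)
  then have s_\<tau>: "s \<tau> = \<tau>'"
    using observer_mink_expand[OF assms(2) unit, of "s \<tau>" \<tau>'] s[OF \<tau>] \<tau>'(1) by simp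

  define d where "d = (1 + mink (S \<tau>) (ddtau I U \<tau>)) / (- mink (U' \<tau>') (U \<tau>))"
  have "(s has_vector_derivative d) (at \<tau> within I)"
    using simultaneity_parameter_has_derivative[OF assms(1,2,4,5) s \<tau>] by (simp add: s_\<tau> S \<tau> d_def)
  \<comment> \<open>The chain rule asks for the derivative within the image of s, a subset of
    \<open>I'\<close>.\<close>
  moreover have "(\<beta>' has_vector_derivative U' \<tau>') (at (s \<tau>) within s ` I)"
    using observer_has_derivative(1)[OF assms(2) \<tau>'(1)] assms(5) s s_\<tau>
    by (auto elim: has_vector_derivative_within_subset)
  ultimately have "((\<beta>' \<circ> s) has_vector_derivative d *\<^sub>R U' \<tau>') (at \<tau> within I)"
    by (rule vector_diff_chain_within)
  from has_vector_derivative_diff[OF this observer_has_derivative(1)[OF assms(1) \<tau>]]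
  have "((\<lambda>t. \<beta>' (s t) - \<beta> t) has_vector_derivative d *\<^sub>R U' \<tau>' - U \<tau>) (at \<tau> within I)"
    using assms(4) by simp
  then have "(S has_vector_derivative d *\<^sub>R U' \<tau>' - U \<tau>) (at \<tau> within I)"
    by (rule has_vector_derivative_transform[rotated 2]) (simp_all add: S \<tau>)
  then have DS: "ddtau I S \<tau> = d *\<^sub>R U' \<tau>' - U \<tau>"
    unfolding ddtau_def
    by (rule vector_derivative_within[OF observer_within_nontrivial[OF assms(1) \<tau>]])
  have d: "d * mink (U' \<tau>') (U \<tau>) = - (1 + mink (S \<tau>) (ddtau I U \<tau>))"
    using neg by (simp add: d_def)
  \<comment> \<open>Projection: as g(U, U) = -1, pairing
    \<open>d *\<^sub>R U' \<tau>' - U \<tau>\<close> with \<open>U \<tau>\<close> gives the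
    coefficient d g(U', U) + 1, which \<open>d\<close> rewrites as - g(S, \<nabla>U).\<close>
  have "fermi_velocity I \<beta> I' \<beta>' \<tau> =
      d *\<^sub>R U' \<tau>' - U \<tau> + (d * mink (U' \<tau>') (U \<tau>) + 1) *\<^sub>R U \<tau>"
    using DS unit(2) assms(4,6)
    by (simp add: fermi_velocity_def Let_def mink.diff_left mink.scaleR_left)
  also have "\<dots> = d *\<^sub>R U' \<tau>' - (1 + mink (S \<tau>) (ddtau I U \<tau>)) *\<^sub>R U \<tau>"
    unfolding d by (simp add: algebra_simps)
  finally show "fermi_velocity I \<beta> I' \<beta>' \<tau> =
      (1 + mink (S \<tau>) (ddtau I U \<tau>)) *\<^sub>R ((1 / (- mink (U' \<tau>') (U \<tau>))) *\<^sub>R U' \<tau>' - U \<tau>)"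
    by (simp add: d_def scaleR_diff_right)
qed

end
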